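(* Let $\beta\in(1,2)$ be a Pisot number. The set of $(\beta,\alpha)\in\Delta(\beta)$ for which $\Omega_{\beta,\alpha}$ is sofic is dense in $\Delta(\beta)$.
   Context: A Pisot number is a real algebraic integer greater than $1$ all of whose other Galois conjugates have modulus strictly less than $1$. For $\beta\in(1,2)$ set $\Delta(\beta) = \{(\beta,\alpha)\in\mathbb{R}^2 : 0\le\alpha\le 2-\beta\}$, with the Euclidean topology. For $\beta\in(1,2)$ and $\alpha\in[0,2-\beta]$ put $p=p_{\beta,\alpha}=(1-\alpha)/\beta$ and $J_{\beta,\alpha}=[-\alpha/(\beta-1),(1-\alpha)/(\beta-1)]$. The maps $T^{\pm}_{\beta,\alpha}:J_{\beta,\alpha}\to J_{\beta,\alpha}$ are: $T^+_{\beta,\alpha}(x)=\beta x+\alpha$ if $x<p$ and $\beta x+\alpha-1$ otherwise; $T^-_{\beta,\alpha}(x)=\beta x+\alpha$ if $x\le p$ and $\beta x+\alpha-1$ otherwise. The expansion maps $\tau^{\pm}_{\beta,\alpha}:J_{\beta,\alpha}\to\{0,1\}^{\mathbb{N}}$ are $\tau^{\pm}_{\beta,\alpha}(x)=(\omega_1^{\pm}(x),\omega_2^{\pm}(x),\dots)$, where $\omega_n^+(x)=0$ if $(T^+_{\beta,\alpha})^{n-1}(x)<p$ and $1$ otherwise, and $\omega_n^-(x)=0$ if $(T^-_{\beta,\alpha})^{n-1}(x)\le p$ and $1$ otherwise. Set $\Omega^{\pm}_{\beta,\alpha}=\tau^{\pm}_{\beta,\alpha}(J_{\beta,\alpha})$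 and $\Omega_{\beta,\alpha}=\Omega^+_{\beta,\alpha}\cup\Omega^-_{\beta,\alpha}$, a subshift of $\{0,1\}^{\mathbb{N}}$ (closed in the product topology and invariant under the left shift). A subshift is of finite type if it is the set of all infinite words avoiding some finite set of finite (forbidden) words; a subshift is sofic if it is a factor (image under a continuous shift-commuting surjection) of a subshift of finite type. *)

theory Defs
  imports "HOL-Analysis.Analysis" "HOL-Computational_Algebra.Computational_Algebra"
begin

section \<open>Pisot numbers\<close>

definition is_min_poly :: "rat poly \<Rightarrow> 'a::field_char_0 \<Rightarrow> bool" where
  "is_min_poly p x \<longleftrightarrow> irreducible p \<and> lead_coeff p = 1 \<and> poly (map_poly of_rat p) x = 0"

definition galois_conjugate :: "real \<Rightarrow> complex \<Rightarrow> bool" where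
  "galois_conjugate x z \<longleftrightarrow> (\<exists>p. is_min_poly p x \<and> poly (map_poly of_rat p) z = 0)"

definition pisot :: "real \<Rightarrow> bool" where
  "pisot \<beta> \<longleftrightarrow> algebraic_int \<beta> \<and> \<beta> > 1 \<and>
     (\<forall>z. galois_conjugate \<beta> z \<and> z \<noteq> of_real \<beta> \<longrightarrow> cmod z < 1)"


section \<open>One-sided subshifts\<close>

text \<open>
  One-sided infinite words over an alphabet \<open>A \<subseteq> UNIV :: nat set\<close> are functions
  \<open>nat \<Rightarrow> nat\<close>. The topology on this type is the product of the discrete topologies, and
  the words over \<open>A\<close> form a closed subset, so that being closed in \<open>nat \<Rightarrow> nat\<close> and
  being closed in the space of words over \<open>A\<close> coincide.
\<close>

definition full_shift :: "nat set \<Rightarrow> (nat \<Rightarrow> nat) set" where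
  "full_shift A = {w. range w \<subseteq> A}"

definition left_shift :: "(nat \<Rightarrow> nat) \<Rightarrow> nat \<Rightarrow> nat" where
  "left_shift w = (\<lambda>n. w (Suc n))"

definition subshift :: "nat set \<Rightarrow> (nat \<Rightarrow> nat) set \<Rightarrow> bool" where
  "subshift A X \<longleftrightarrow> finite A \<and> X \<subseteq> full_shift A \<and> closed X \<and> left_shift ` X \<subseteq> X"

definition occurs_in :: "nat list \<Rightarrow> (nat \<Rightarrow> nat) \<Rightarrow> bool" where
  "occurs_in u w \<longleftrightarrow> (\<exists>k. map w [k..<k + length u] = u)"

definition finite_type :: "nat set \<Rightarrow> (nat \<Rightarrow> nat) set \<Rightarrow> bool" where
  "finite_type A X \<longleftrightarrow> subshift A X \<and>
     (\<exists>F. finite F \<and> X = {w \<in> full_shift A. \<forall>u\<in>F. \<not> occurs_in u w})"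

text \<open>The subshift of finite type may live over an arbitrary finite alphabet \<open>B\<close>,
  unrelated to \<open>A\<close>.\<close>

definition sofic :: "nat set \<Rightarrow> (nat \<Rightarrow> nat) set \<Rightarrow> bool" where
  "sofic A X \<longleftrightarrow> subshift A X \<and>
     (\<exists>B Y \<phi>. finite_type B Y \<and> continuous_on Y \<phi> \<and> \<phi> ` Y = X \<and>
        (\<forall>y\<in>Y. \<phi> (left_shift y) = left_shift (\<phi> y)))"


section \<open>Intermediate beta-shifts\<close>

definition Delta :: "real \<Rightarrow> (real \<times> real) set" where
  "Delta \<beta> = {(b, \<alpha>). b = \<beta> \<and> 0 \<le> \<alpha> \<and> \<alpha> \<le> 2 - \<beta>}"

definition crit :: "real \<Rightarrow> real \<Rightarrow> real" where
  "crit \<beta> \<alpha> = (1 - \<alpha>) / \<beta>"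

definition J :: "real \<Rightarrow> real \<Rightarrow> real set" where
  "J \<beta> \<alpha> = {- \<alpha> / (\<beta> - 1) .. (1 - \<alpha>) / (\<beta> - 1)}"

text \<open>For \<open>1 < \<beta>\<close> and \<open>0 \<le> \<alpha> \<le> 2 - \<beta>\<close> both maps below send \<open>J \<beta> \<alpha>\<close> into itself;
  they are defined on all reals but only ever evaluated on orbits starting in \<open>J \<beta> \<alpha>\<close>.\<close>

definition T_plus :: "real \<Rightarrow> real \<Rightarrow> real \<Rightarrow> real" where
  "T_plus \<beta> \<alpha> x = (if x < crit \<beta> \<alpha> then \<beta> * x + \<alpha> else \<beta> * x + \<alpha> - 1)"

definition T_minus :: "real \<Rightarrow> real \<Rightarrow> real \<Rightarrow> real" where
  "T_minus \<beta> \<alpha> x = (if x \<le> crit \<beta> \<alpha> then \<beta> * x + \<alpha> else \<beta> * x + \<alpha> - 1)"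

text \<open>The letter \<open>\<omega>\<^sub>n\<close>, \<open>n \<ge> 1\<close>, of an expansion is stored at index \<open>n - 1\<close>.\<close>

definition tau_plus :: "real \<Rightarrow> real \<Rightarrow> real \<Rightarrow> nat \<Rightarrow> nat" where
  "tau_plus \<beta> \<alpha> x = (\<lambda>n. if (T_plus \<beta> \<alpha> ^^ n) x < crit \<beta> \<alpha> then 0 else 1)"

definition tau_minus :: "real \<Rightarrow> real \<Rightarrow> real \<Rightarrow> nat \<Rightarrow> nat" where
  "tau_minus \<beta> \<alpha> x = (\<lambda>n. if (T_minus \<beta> \<alpha> ^^ n) x \<le> crit \<beta> \<alpha> then 0 else 1)"

definition Omega_plus :: "real \<Rightarrow> real \<Rightarrow> (nat \<Rightarrow> nat) set" where
  "Omega_plus \<beta> \<alpha> = tau_plus \<beta> \<alpha> ` J \<beta> \<alpha>"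

definition Omega_minus :: "real \<Rightarrow> real \<Rightarrow> (nat \<Rightarrow> nat) set" where
  "Omega_minus \<beta> \<alpha> = tau_minus \<beta> \<alpha> ` J \<beta> \<alpha>"

definition Omega :: "real \<Rightarrow> real \<Rightarrow> (nat \<Rightarrow> nat) set" where
  "Omega \<beta> \<alpha> = Omega_plus \<beta> \<alpha> \<union> Omega_minus \<beta> \<alpha>"

end

theory Submission
  imports Defs
begin

text \<open>
  Every rational \<open>\<alpha> = a / q\<close> works. If a point \<open>x\<close> satisfies \<open>q x = P(\<beta>)\<close> with an integer
  polynomial \<open>P\<close>, then so do \<open>\<beta> x + \<alpha>\<close> and \<open>\<beta> x + \<alpha> - 1\<close>, and since the other conjugates of
  \<open>\<beta>\<close> lie in a disc of radius less than 1, a suitable bound on the conjugates of \<open>P(\<beta>)\<close> is preserved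
  too. Only finitely many points of the interval satisfy such a bound, and together with the endpoints
  and the critical point they form a Markov partition. The words of the intermediate beta-shift are
  exactly the label sequences of the infinite paths through the gaps of this partition.
\<close>

section \<open>Integer polynomials with bounded conjugates\<close>

lemma map_poly_of_rat_hom:
  fixes p q :: "rat poly"
  shows "map_poly (of_rat :: rat \<Rightarrow> 'a::field_char_0) (p + q) = map_poly of_rat p + map_poly of_rat q"
    and "map_poly (of_rat :: rat \<Rightarrow> 'a) (p * q) = map_poly of_rat p * map_poly of_rat q"
    and "map_poly (of_rat :: rat \<Rightarrow> 'a) (smult c p) = smult (of_rat c) (map_poly of_rat p)"
    and "map_poly (of_rat :: rat \<Rightarrow> 'a) (pderiv p) = pderiv (map_poly of_rat p)"
    and "degree (map_poly (of_rat :: rat \<Rightarrow> 'a) p) = degree p"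
  by (auto intro!: poly_eqI degree_map_poly
      simp: coeff_map_poly of_rat_add of_rat_mult coeff_mult of_rat_sum coeff_pderiv)

lemma map_poly_of_int_hom:
  fixes p q :: "int poly"
  shows "map_poly (of_int :: int \<Rightarrow> 'a::field_char_0) (p - q) = map_poly of_int p - map_poly of_int q"
    and "map_poly (of_int :: int \<Rightarrow> 'a) (smult c p) = smult (of_int c) (map_poly of_int p)"
    and "map_poly (of_int :: int \<Rightarrow> 'a) (pCons c p) = pCons (of_int c) (map_poly of_int p)"
  by (auto intro!: poly_eqI simp: coeff_map_poly map_poly_pCons)

lemma poly_map_poly_of_int_complex_of_real:
  "poly (map_poly of_int P) (complex_of_real x) = complex_of_real (poly (map_poly of_int P) x)"
  by (induction P) (auto simp: map_poly_of_int_hom)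

lemma poly_map_poly_of_rat_of_int:
  "poly (map_poly of_rat (map_poly of_int P)) x = poly (map_poly of_int P) x"
  by (simp add: map_poly_map_poly o_def)

section \<open>Minimal polynomials over the rationals and their complex roots\<close>

text \<open>A nonzero vanishing polynomial of least degree, made monic, leaves remainder 0 in every
  other one. In a factorisation, a factor vanishing at \<open>x\<close> already has full degree, so
  its cofactor is constant. The field is left general because the lemma serves both the real \<beta>
  and complex conjugates.\<close>

lemma ex_min_poly:
  fixes x :: "'a::field_char_0"
  assumes "h \<noteq> 0" and "poly (map_poly of_rat h) x = 0"
  obtains m where "is_min_poly m x" and "\<And>h. poly (map_poly of_rat h) x = 0 \<Longrightarrow> m dvd h"
proof -
  define V where "V h \<longleftrightarrow> h \<noteq> 0 \<and> poly (map_poly of_rat h) x = 0" for h :: "rat poly"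
  obtain m0 where m0: "V m0" and min0: "\<And>h. V h \<Longrightarrow> degree m0 \<le> degree h"
    using assms arg_min_natI[of V h degree] arg_min_nat_le[of V _ degree]
    unfolding V_def by blast
  define m where "m = smult (1 / lead_coeff m0) m0"
  have m: "V m" "lead_coeff m = 1" "degree m = degree m0"
    using m0 by (auto simp: m_def V_def map_poly_of_rat_hom)
  have min: "degree m \<le> degree h" if "V h" for h
    using min0[OF that] m by simp
  have dvd: "m dvd h" if "poly (map_poly of_rat h) x = 0" for h
  proof -
    have "h = h div m * m + h mod m" by simp
    then have "poly (map_poly of_rat (h mod m)) x = 0"
      using that m(1) unfolding V_def
      by (metis add_0 map_poly_of_rat_hom(1,2) mult_zero_right poly_add poly_mult)
    moreover have "h mod m = 0 \<or> degree (h mod m) < degree m"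
      using degree_mod_less m(1) unfolding V_def by blast
    ultimately show ?thesis
      using min[of "h mod m"] unfolding V_def by (meson linorder_not_less mod_eq_0_iff_dvd)
  qed
  have "degree m \<noteq> 0"
  proof
    assume "degree m = 0"
    then obtain a where "m = [:a:]" by (rule degree_eq_zeroE)
    then show False using m(1) by (auto simp: V_def map_poly_pCons)
  qed
  have unit: "is_unit b" if "m = a * b" "poly (map_poly of_rat a) x = 0" for a b
  proof -
    have "a \<noteq> 0" "b \<noteq> 0" using that(1) m(1) by (auto simp: V_def)
    then have "degree m = degree a + degree b" using that(1) by (simp add: degree_mult_eq)
    moreover have "degree m \<le> degree a" using min[of a] that \<open>a \<noteq> 0\<close> by (auto simp: V_def)
    ultimately show ?thesis using \<open>b \<noteq> 0\<close> by (simp add: is_unit_iff_degree)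
  qed
  have "irreducible m"
  proof (rule irreducibleI)
    show "m \<noteq> 0" using m(1) by (simp add: V_def)
    show "\<not> is_unit m" using \<open>degree m \<noteq> 0\<close> \<open>m \<noteq> 0\<close> by (simp add: is_unit_iff_degree)
    fix a b assume ab: "m = a * b"
    then have "poly (map_poly of_rat a) x = 0 \<or> poly (map_poly of_rat b) x = 0"
      using m(1) by (auto simp: V_def map_poly_of_rat_hom)
    then show "is_unit a \<or> is_unit b"
      using unit[of a b] unit[of b a] ab by (auto simp: mult.commute)
  qed
  then show ?thesis using that[of m] dvd m by (auto simp: is_min_poly_def V_def)
qed

text \<open>An irreducible \<open>p\<close> divides the minimal polynomial of each of its roots. A
  root shared with the derivative would thus make \<open>p\<close> divide a polynomial that is
  nonzero in characteristic 0 and of smaller degree.\<close>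

lemma irreducible_rat_poly_separable:
  fixes p :: "rat poly" and z :: complex
  assumes "irreducible p" and "poly (map_poly of_rat p) z = 0"
  shows "poly (pderiv (map_poly of_rat p)) z \<noteq> 0"
proof
  assume "poly (pderiv (map_poly of_rat p)) z = 0"
  then have z: "poly (map_poly of_rat (pderiv p)) z = 0" by (simp add: map_poly_of_rat_hom)
  have p0: "p \<noteq> 0" and pu: "\<not> is_unit p" using assms(1) by (auto simp: irreducible_def)
  obtain m where m: "is_min_poly m z" "\<And>h. poly (map_poly of_rat h) z = 0 \<Longrightarrow> m dvd h"
    by (rule ex_min_poly[OF p0 assms(2)]) (rule that)
  have "\<not> is_unit m" using m(1) irreducible_not_unit by (auto simp: is_min_poly_def)
  then have "p dvd m" using irreducibleD'[OF assms(1) m(2)[OF assms(2)]] by simp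
  then have "p dvd pderiv p" using m(2)[OF z] by (rule dvd_trans)
  moreover have "degree p \<noteq> 0" using pu p0 by (simp add: is_unit_iff_degree)
  ultimately show False
    using dvd_imp_degree_le[of p "pderiv p"] by (auto simp: degree_pderiv pderiv_eq_0_iff)
qed

text \<open>By separability the roots are simple. The exact count matters: a polynomial of degree
  below \<open>degree p\<close> is then determined by its values at the roots of
  \<open>p\<close>.\<close>

lemma card_roots_irreducible_rat_poly:
  fixes p :: "rat poly"
  assumes "irreducible p"
  shows "card {z :: complex. poly (map_poly of_rat p) z = 0} = degree p"
proof -
  let ?p = "map_poly of_rat p :: complex poly"
  have p0: "?p \<noteq> 0" using assms by (auto simp: map_poly_eq_0_iff irreducible_def)
  have "rsquarefree ?p"
    using irreducible_rat_poly_separable[OF assms] by (auto simp: rsquarefree_roots)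
  then have "smult (lead_coeff ?p) (\<Prod>z | poly ?p z = 0. [:- z, 1:]) = ?p"
    by (rule complex_poly_decompose_rsquarefree)
  then have "degree ?p = degree (\<Prod>z | poly ?p z = 0. [:- z, 1:])"
    using p0 by (metis degree_smult_eq leading_coeff_0_iff)
  also have "\<dots> = card {z. poly ?p z = 0}"
    by (subst degree_prod_sum_eq) auto
  finally show ?thesis by (simp add: map_poly_of_rat_hom)
qed

section \<open>Finiteness of points with bounded conjugates\<close>

lemma clear_denominators:
  fixes p :: "rat poly"
  obtains N :: int and g where "N > 0" and "map_poly of_int g = smult (of_int N) p"
proof -
  have "\<exists>N>0. \<exists>g. map_poly of_int g = smult (of_int N) p"
  proof (induction p)
    case 0
    show ?case by (intro exI[of _ 1] conjI exI[of _ 0]) auto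
  next
    case (pCons a p)
    then obtain N g where N: "N > 0" "map_poly of_int g = smult (of_int N) p" by blast
    obtain u v where uv: "quotient_of a = (u, v)" by fastforce
    then have "v > 0" "a = of_int u / of_int v"
      using quotient_of_denom_pos quotient_of_div by auto
    then have "N * v > 0"
      "map_poly of_int (pCons (N * u) (smult v g)) = smult (of_int (N * v)) (pCons a p)"
      using N by (auto simp: map_poly_of_int_hom mult.commute)
    then show ?case by blast
  qed
  then show ?thesis using that by blast
qed

text \<open>Pseudo-division by \<open>g\<close>, seen only through the values at the roots \<open>Z\<close> of \<open>g\<close>.
  For monic \<open>g\<close> the factor is 1 whatever the degree of \<open>Q\<close>.\<close>

lemma reduce_modulo_vanishing:
  fixes g Q :: "int poly" and Z :: "'a::field_char_0 set"
  assumes "\<forall>z\<in>Z. poly (map_poly of_int g) z = 0" and "\<forall>i\<ge>k. coeff Q i = 0"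
  shows "\<exists>R. (\<forall>i\<ge>degree g. coeff R i = 0) \<and>
    (\<forall>z\<in>Z. of_int (lead_coeff g) ^ k * poly (map_poly of_int Q) z = poly (map_poly of_int R) z)"
  using assms(2)
proof (induction k arbitrary: Q)
  case 0
  then have "Q = 0" by (auto intro: poly_eqI)
  then show ?case by (intro exI[of _ 0]) auto
next
  case (Suc k)
  obtain a Q' where Q: "Q = pCons a Q'" by (rule pCons_cases)
  have "\<forall>i\<ge>k. coeff Q' i = 0" using Suc.prems by (auto simp: Q dest: spec[of _ "Suc _"])
  from Suc.IH[OF this] obtain R' where R': "\<forall>i\<ge>degree g. coeff R' i = 0"
    "\<And>z. z \<in> Z \<Longrightarrow> of_int (lead_coeff g) ^ k * poly (map_poly of_int Q') z = poly (map_poly of_int R') z"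
    by blast
  define c where "c = lead_coeff g"
  define S where "S = pCons (c ^ k * a) R'"
  \<comment> \<open>\<open>S\<close> has no coefficient beyond index \<open>degree g\<close>.
    Subtracting this multiple of \<open>g\<close> cancels the one at that index, at the price of one
    more factor \<open>c\<close>.\<close>
  define R where "R = smult c S - smult (coeff S (degree g)) g"
  have "coeff R i = 0" if "i \<ge> degree g" for i
  proof (cases "i = degree g")
    case False
    define j where "j = i - 1"
    have "i = Suc j" "j \<ge> degree g" using False that by (auto simp: j_def)
    then show ?thesis using R'(1) by (simp add: R_def S_def coeff_eq_0)
  qed (simp add: R_def c_def)
  moreover have "of_int c ^ Suc k * poly (map_poly of_int Q) z = poly (map_poly of_int R) z"
    if "z \<in> Z" for z
  proof -
    have "poly (map_poly of_int R) z = of_int c * (of_int c ^ k * of_int a + z * poly (map_poly of_int R') z)"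
      using assms(1) that by (simp add: R_def S_def map_poly_of_int_hom algebra_simps)
    also have "\<dots> = of_int c ^ Suc k * poly (map_poly of_int Q) z"
      by (simp add: R'(2)[OF that, symmetric, folded c_def] Q map_poly_of_int_hom algebra_simps)
    finally show ?thesis ..
  qed
  ultimately show ?case unfolding c_def by blast
qed

text \<open>Lagrange interpolation writes the coefficients of \<open>R\<close> as fixed linear
  combinations of its values on \<open>Z\<close>. Bounded values therefore give bounded
  coefficients, and these are integers.\<close>

lemma finite_int_polys_bounded_values:
  fixes Z :: "complex set"
  assumes "finite Z"
  shows "finite {R :: int poly. (\<forall>i\<ge>card Z. coeff R i = 0) \<and>
    (\<forall>z\<in>Z. cmod (poly (map_poly of_int R) z) \<le> K)}" (is "finite ?A")
proof -
  \<comment> \<open>The Lagrange basis polynomial of the node \<open>z\<close>.\<close>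
  define L where "L z = smult (1 / (\<Prod>y\<in>Z - {z}. z - y)) (\<Prod>y\<in>Z - {z}. [:- y, 1:])" for z
  have L: "poly (L z) y = (if y = z then 1 else 0)" if "y \<in> Z" "z \<in> Z" for y z
    using that assms by (auto simp: L_def poly_prod)
  have degL: "degree (L z) < card Z" if "z \<in> Z" for z
  proof -
    have "degree (L z) \<le> (\<Sum>y\<in>Z - {z}. degree [:- y, 1:])"
      unfolding L_def using degree_prod_sum_le[of "Z - {z}" "\<lambda>y. [:- y, 1:]"] assms
      by (simp add: o_def)
    also have "\<dots> = card Z - 1" using that assms by simp
    also have "\<dots> < card Z" using that assms by (metis card_gt_0_iff diff_less empty_iff zero_less_one)
    finally show ?thesis .
  qed
  define B where "B = (\<Sum>z\<in>Z. \<Sum>i<card Z. K * cmod (coeff (L z) i))"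
  have bound: "\<bar>coeff R i\<bar> \<le> \<lfloor>B\<rfloor>" if R: "R \<in> ?A" and i: "i < card Z" for R i
  proof -
    have "map_poly of_int R = (\<Sum>z\<in>Z. smult (poly (map_poly of_int R) z) (L z))" (is "?R = ?S")
    proof (rule poly_eqI_degree[of Z])
      show "poly ?R y = poly ?S y" if "y \<in> Z" for y
      proof -
        have "poly ?S y = (\<Sum>z\<in>Z. if y = z then poly ?R z else 0)"
          unfolding poly_sum poly_smult by (rule sum.cong) (auto simp: L that)
        then show ?thesis using that assms by simp
      qed
      show "card Z > degree ?R"
        using R i degree_le[of "card Z - 1" ?R] by (auto simp: coeff_map_poly)
      show "card Z > degree ?S"
      proof -
        have "degree ?S \<le> card Z - 1"
          using degL assms by (intro degree_sum_le order_trans[OF degree_smult_le]) fastforce+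
        then show ?thesis using i by linarith
      qed
    qed
    then have "of_int (coeff R i) = coeff ?S i" by (metis coeff_map_poly of_int_0)
    then have "cmod (of_int (coeff R i)) = cmod (\<Sum>z\<in>Z. poly ?R z * coeff (L z) i)"
      by (simp add: coeff_sum)
    also have "\<dots> \<le> (\<Sum>z\<in>Z. K * cmod (coeff (L z) i))"
      using R by (intro sum_norm_le) (auto simp: norm_mult intro!: mult_right_mono)
    also have "\<dots> \<le> B"
      unfolding B_def
    proof (rule sum_mono)
      fix z assume "z \<in> Z"
      then have "0 \<le> K" using R by (auto intro: order_trans[OF norm_ge_zero])
      then show "K * cmod (coeff (L z) i) \<le> (\<Sum>i<card Z. K * cmod (coeff (L z) i))"
        using i by (intro member_le_sum) auto
    qed
    finally show ?thesis by (simp add: le_floor_iff)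
  qed
  have "R \<in> Poly ` {xs. set xs \<subseteq> {- \<lfloor>B\<rfloor>..\<lfloor>B\<rfloor>} \<and> length xs = card Z}" if R: "R \<in> ?A" for R
  proof (rule image_eqI)
    show "R = Poly (map (coeff R) [0..<card Z])"
      using R by (intro poly_eqI) (auto simp: nth_default_def)
    show "map (coeff R) [0..<card Z] \<in> {xs. set xs \<subseteq> {- \<lfloor>B\<rfloor>..\<lfloor>B\<rfloor>} \<and> length xs = card Z}"
      using bound[OF R] by (force simp: abs_le_iff)
  qed
  then have "?A \<subseteq> Poly ` {xs. set xs \<subseteq> {- \<lfloor>B\<rfloor>..\<lfloor>B\<rfloor>} \<and> length xs = card Z}" by blast
  then show ?thesis
    by (rule finite_subset) (intro finite_imageI finite_lists_length_eq finite_atLeastAtMost_int)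
qed

text \<open>The numbers \<open>q * x\<close> lie in the ring generated by \<beta>, and the values of
  \<open>P\<close> at the roots of the minimal polynomial are their conjugates. Reducing
  \<open>P\<close> below the degree of that polynomial makes interpolation at these roots
  applicable, and the reduced polynomial still determines \<open>x\<close>.\<close>

lemma finite_bounded_conjugates:
  fixes \<beta> q :: real
  assumes "algebraic_int \<beta>" and "q \<noteq> 0"
  shows "finite {x. \<bar>q * x\<bar> \<le> K \<and> (\<exists>P :: int poly. q * x = poly (map_poly of_int P) \<beta> \<and>
    (\<forall>z. galois_conjugate \<beta> z \<and> z \<noteq> of_real \<beta> \<longrightarrow> cmod (poly (map_poly of_int P) z) \<le> K))}"
    (is "finite ?X")
proof -
  obtain f :: "int poly" where f: "poly (map_poly of_int f) \<beta> = 0" "lead_coeff f = 1"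
    using assms(1) unfolding algebraic_int_altdef_ipoly by blast
  have "(map_poly of_int f :: rat poly) \<noteq> 0" using f(2) by (auto simp: map_poly_eq_0_iff)
  then obtain p where p: "is_min_poly p \<beta>"
    and dvd: "\<And>h. poly (map_poly of_rat h) \<beta> = 0 \<Longrightarrow> p dvd h"
    using ex_min_poly[of "map_poly of_int f" \<beta>] f(1) by (metis poly_map_poly_of_rat_of_int)
  define Z where "Z = {z :: complex. poly (map_poly of_rat p) z = 0}"
  define Z' where "Z' = insert (of_real \<beta>) Z"
  have p0: "p \<noteq> 0" and irr: "irreducible p" using p by (auto simp: is_min_poly_def irreducible_def)
  have "finite Z"
    unfolding Z_def by (rule poly_roots_finite) (use p0 in \<open>auto simp: map_poly_eq_0_iff\<close>)
  have "card Z = degree p" unfolding Z_def by (rule card_roots_irreducible_rat_poly[OF irr])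
  have vanish: "\<forall>z\<in>Z'. poly (map_poly of_int h) z = 0" if "poly (map_poly of_int h) \<beta> = 0" for h
  proof -
    have "p dvd map_poly of_int h" using dvd that by (metis poly_map_poly_of_rat_of_int)
    then obtain h' where "map_poly of_int h = p * h'" by blast
    then have "poly (map_poly of_int h) z = 0" if "z \<in> Z" for z
      using that by (subst poly_map_poly_of_rat_of_int[symmetric]) (simp add: Z_def map_poly_of_rat_hom)
    then show ?thesis using that by (simp add: Z'_def poly_map_poly_of_int_complex_of_real)
  qed
  obtain N g where N: "N > 0" and g: "map_poly of_int g = smult (of_int N) p"
    by (rule clear_denominators)
  have "degree g = degree (map_poly of_int g :: rat poly)" by (simp add: degree_map_poly)
  then have degg: "degree g = card Z" using N \<open>card Z = degree p\<close> by (simp add: g)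
  have "g \<noteq> 0" using g N p0 by auto
  have "poly (map_poly of_int g) \<beta> = 0"
    by (subst poly_map_poly_of_rat_of_int[symmetric])
      (use p in \<open>simp add: g map_poly_of_rat_hom is_min_poly_def\<close>)
  note vg = vanish[OF this] and vf = vanish[OF f(1)]
  \<comment> \<open>Reduction by \<open>g\<close> costs a power of its leading coefficient. Each
    \<open>P\<close> is first reduced by the monic \<open>f\<close>, which leaves the values
    unchanged and bounds the degree, so that one constant \<open>c\<close> serves all
    \<open>P\<close>.\<close>
  define c :: int where "c = lead_coeff g ^ degree f"
  have "c \<noteq> 0" using \<open>g \<noteq> 0\<close> by (simp add: c_def)
  define A where "A = {R :: int poly. (\<forall>i\<ge>card Z. coeff R i = 0) \<and>
    (\<forall>z\<in>Z. cmod (poly (map_poly of_int R) z) \<le> \<bar>of_int c\<bar> * K)}"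
  have "finite A" unfolding A_def by (rule finite_int_polys_bounded_values[OF \<open>finite Z\<close>])
  have "x \<in> (\<lambda>R. poly (map_poly of_int R) \<beta> / (of_int c * q)) ` A" if xX: "x \<in> ?X" for x
  proof -
    obtain P where xK: "\<bar>q * x\<bar> \<le> K" and P: "q * x = poly (map_poly of_int P) \<beta>"
      and "\<forall>z. galois_conjugate \<beta> z \<and> z \<noteq> of_real \<beta> \<longrightarrow> cmod (poly (map_poly of_int P) z) \<le> K"
      using xX by blast
    then have PK: "cmod (poly (map_poly of_int P) z) \<le> K"
      if "galois_conjugate \<beta> z" "z \<noteq> of_real \<beta>" for z using that by blast
    have bd: "cmod (poly (map_poly of_int P) z) \<le> K" if "z \<in> Z" for z
    proof (cases "z = of_real \<beta>")
      case True
      then show ?thesis using xK P by (simp add: poly_map_poly_of_int_complex_of_real)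
    next
      case False
      then show ?thesis using PK that p by (auto simp: galois_conjugate_def Z_def)
    qed
    have "\<forall>i\<ge>Suc (degree P). coeff P i = 0" by (auto intro: coeff_eq_0)
    from reduce_modulo_vanishing[OF vf this] f(2)
    obtain Q where Q: "\<forall>i\<ge>degree f. coeff Q i = 0"
      "\<And>z. z \<in> Z' \<Longrightarrow> poly (map_poly of_int P) z = poly (map_poly of_int Q) z" by auto
    from reduce_modulo_vanishing[OF vg Q(1)]
    obtain R where R: "\<forall>i\<ge>card Z. coeff R i = 0"
      "\<And>z. z \<in> Z' \<Longrightarrow> of_int c * poly (map_poly of_int Q) z = poly (map_poly of_int R) z"
      unfolding degg c_def by auto
    have PR: "poly (map_poly of_int R) z = of_int c * poly (map_poly of_int P) z" if "z \<in> Z'" for z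
      using R(2) Q(2) that by simp
    have "R \<in> A"
      unfolding A_def using R(1) PR bd by (auto simp: Z'_def norm_mult intro!: mult_left_mono)
    moreover have "poly (map_poly of_int R) \<beta> = of_int c * (q * x)"
    proof -
      have "complex_of_real (poly (map_poly of_int R) \<beta>) = of_real (of_int c * (q * x))"
        using PR[of "of_real \<beta>"] P by (simp add: Z'_def poly_map_poly_of_int_complex_of_real)
      then show ?thesis using of_real_eq_iff by blast
    qed
    ultimately show ?thesis
      using \<open>c \<noteq> 0\<close> assms(2) by (intro image_eqI[of _ _ R]) auto
  qed
  then have "?X \<subseteq> (\<lambda>R. poly (map_poly of_int R) \<beta> / (of_int c * q)) ` A" by (rule subsetI)
  then show ?thesis by (rule finite_surj[OF \<open>finite A\<close>])
qed

text \<open>The polynomial in \<open>galois_conjugate\<close> may vary with the conjugate, but each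
  one divides \<open>h\<close>. So there are finitely many conjugates, and their strict bounds have
  a common one below 1.\<close>

lemma pisot_conjugate_bound:
  assumes "pisot \<beta>"
  obtains r where "0 \<le> r" "r < 1" "\<And>z. galois_conjugate \<beta> z \<Longrightarrow> z \<noteq> of_real \<beta> \<Longrightarrow> cmod z \<le> r"
proof -
  obtain f :: "int poly" where f: "poly (map_poly of_int f) \<beta> = 0" "lead_coeff f = 1"
    using assms unfolding pisot_def algebraic_int_altdef_ipoly by blast
  define h where "h = (map_poly of_int f :: rat poly)"
  have h: "h \<noteq> 0" "poly (map_poly of_rat h) \<beta> = 0"
    using f by (auto simp: h_def poly_map_poly_of_rat_of_int map_poly_eq_0_iff)
  define C where "C = {z. galois_conjugate \<beta> z \<and> z \<noteq> of_real \<beta>}"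
  have "C \<subseteq> {z. poly (map_poly of_rat h) z = 0}"
  proof
    fix z assume "z \<in> C"
    then obtain p where p: "is_min_poly p \<beta>" "poly (map_poly of_rat p) z = 0"
      by (auto simp: C_def galois_conjugate_def)
    obtain m where m: "is_min_poly m \<beta>" "\<And>h. poly (map_poly of_rat h) \<beta> = 0 \<Longrightarrow> m dvd h"
      by (rule ex_min_poly[OF h]) (rule that)
    then have "m dvd p" using p(1) by (simp add: is_min_poly_def)
    moreover have "irreducible p" "\<not> is_unit m"
      using p(1) m(1) irreducible_not_unit by (auto simp: is_min_poly_def)
    ultimately have "p dvd m" using irreducibleD'[of p m] by simp
    then have "p dvd h" using m(2)[OF h(2)] dvd_trans by blast
    then show "z \<in> {z. poly (map_poly of_rat h) z = 0}"
      using p(2) by (auto simp: map_poly_of_rat_hom)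
  qed
  moreover have "finite {z :: complex. poly (map_poly of_rat h) z = 0}"
    by (rule poly_roots_finite) (use h in \<open>auto simp: map_poly_eq_0_iff\<close>)
  ultimately have "finite C" using finite_subset by blast
  have C1: "cmod z < 1" if "z \<in> C" for z using that assms by (auto simp: C_def pisot_def)
  \<comment> \<open>Inserting 0 gives \<open>0 \<le> r\<close> and keeps the maximum meaningful when
    there are no other conjugates.\<close>
  show ?thesis
    by (rule that[of "Max (insert 0 (cmod ` C))"])
      (use \<open>finite C\<close> C1 in \<open>auto simp: C_def\<close>)
qed

section \<open>Sofic shifts from Markov partitions\<close>

definition vertex_shift :: "nat set \<Rightarrow> (nat \<Rightarrow> nat \<Rightarrow> bool) \<Rightarrow> (nat \<Rightarrow> nat) set" where
  "vertex_shift B E = {w \<in> full_shift B. \<forall>n. E (w n) (w (Suc n))}"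

text \<open>Tychonoff's theorem; with index set \<open>UNIV\<close> the extensional product is the
  whole function set. Compactness will make images of vertex shifts closed.\<close>

lemma compact_full_shift:
  assumes "finite B"
  shows "compact (full_shift B)"
proof -
  have "compactin (product_topology (\<lambda>i. euclidean) UNIV) (\<Pi>\<^sub>E i\<in>(UNIV :: nat set). B)"
    using assms finite_imp_compact by (subst compactin_PiE) auto
  moreover have "(\<Pi>\<^sub>E i\<in>(UNIV :: nat set). B) = full_shift B"
    by (auto simp: full_shift_def)
  ultimately show ?thesis by (simp add: euclidean_product_topology)
qed

lemma compact_imp_closed_fun:
  fixes S :: "(nat \<Rightarrow> nat) set"
  assumes "compact S"
  shows "closed S"
proof -
  have "Hausdorff_space (euclidean :: nat topology)"
    unfolding Hausdorff_space_def
  proof (intro allI impI)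
    fix x y :: nat
    assume "x \<in> topspace euclidean \<and> y \<in> topspace euclidean \<and> x \<noteq> y"
    then show "\<exists>U V. openin euclidean U \<and> openin euclidean V \<and> x \<in> U \<and> y \<in> V \<and> disjnt U V"
      by (intro exI[of _ "{x}"] exI[of _ "{y}"]) (auto simp: open_discrete)
  qed
  then have "Hausdorff_space (euclidean :: (nat \<Rightarrow> nat) topology)"
    unfolding euclidean_product_topology[symmetric] Hausdorff_space_product_topology by blast
  then show ?thesis
    using assms compactin_imp_closedin[of euclidean S] by simp
qed

lemma closed_vertex_shift:
  assumes "finite B"
  shows "closed (vertex_shift B E)"
proof -
  have cl: "closed {w :: nat \<Rightarrow> nat. E (w n) (w (Suc n))}" for n
  proof -
    have "continuous_on UNIV (\<lambda>w :: nat \<Rightarrow> nat. (w n, w (Suc n)))"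
      by (intro continuous_on_Pair continuous_on_product_coordinates)
    moreover have "closed {p :: nat \<times> nat. E (fst p) (snd p)}"
    proof -
      have "open {p :: nat \<times> nat. \<not> E (fst p) (snd p)}"
      proof (rule open_prod_intro)
        fix p :: "nat \<times> nat" assume "p \<in> {p. \<not> E (fst p) (snd p)}"
        then show "\<exists>A B. open A \<and> open B \<and> p \<in> A \<times> B \<and> A \<times> B \<subseteq> {p. \<not> E (fst p) (snd p)}"
          by (intro exI[of _ "{fst p}"] exI[of _ "{snd p}"]) (auto simp: open_discrete mem_Times_iff)
      qed
      then show ?thesis by (simp add: closed_def Collect_neg_eq[symmetric])
    qed
    ultimately show ?thesis
      using closed_vimage[of "{p. E (fst p) (snd p)}" "\<lambda>w :: nat \<Rightarrow> nat. (w n, w (Suc n))"]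
      by (simp add: vimage_def)
  qed
  have "vertex_shift B E = full_shift B \<inter> (\<Inter>n. {w. E (w n) (w (Suc n))})"
    by (auto simp: vertex_shift_def)
  then show ?thesis
    using cl compact_imp_closed_fun[OF compact_full_shift[OF assms]] by (auto intro!: closed_Int closed_INT)
qed

text \<open>The forbidden words are the two-letter words over \<open>B\<close> that are not
  edges.\<close>

lemma finite_type_vertex_shift:
  assumes "finite B"
  shows "finite_type B (vertex_shift B E)"
proof -
  define F where "F = (\<lambda>(i, j). [i, j]) ` {(i, j) \<in> B \<times> B. \<not> E i j}"
  have "finite F" using assms by (auto simp: F_def intro: finite_subset[of _ "B \<times> B"])
  moreover have "vertex_shift B E = {w \<in> full_shift B. \<forall>u\<in>F. \<not> occurs_in u w}"
    by (auto simp: vertex_shift_def full_shift_def F_def occurs_in_def upt_rec) blast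
  moreover have "left_shift ` vertex_shift B E \<subseteq> vertex_shift B E"
    by (auto simp: vertex_shift_def full_shift_def left_shift_def)
  ultimately show ?thesis
    using assms closed_vertex_shift[OF assms, of E]
    unfolding finite_type_def subshift_def by (auto simp: vertex_shift_def[of B E])
qed

text \<open>Relabelling letter by letter is continuous and commutes with the shift. The image is
  closed, hence a subshift, as a continuous image of a compact set.\<close>

lemma sofic_labelled_vertex_shift:
  assumes "finite A" and "finite B" and "l ` B \<subseteq> A"
  shows "sofic A ((\<lambda>w. l \<circ> w) ` vertex_shift B E)"
proof -
  have cont: "continuous_on (vertex_shift B E) (\<lambda>w. l \<circ> w)"
  proof (rule continuous_on_coordinatewise_then_product)
    fix i
    have "continuous_on (vertex_shift B E) (\<lambda>w. w i)"
      by (rule continuous_on_product_then_coordinatewise) (rule continuous_on_id)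
    moreover have "continuous_on UNIV l" by simp
    ultimately show "continuous_on (vertex_shift B E) (\<lambda>w. (l \<circ> w) i)"
      using continuous_on_compose2[of UNIV l] by auto
  qed
  have "vertex_shift B E = full_shift B \<inter> vertex_shift B E" by (auto simp: vertex_shift_def)
  then have "compact (vertex_shift B E)"
    using compact_full_shift[OF assms(2)] closed_vertex_shift[OF assms(2)] compact_Int_closed by metis
  then have "closed ((\<lambda>w. l \<circ> w) ` vertex_shift B E)"
    using compact_imp_closed_fun[OF compact_continuous_image[OF cont]] by simp
  moreover have "left_shift (l \<circ> w) = l \<circ> left_shift w" for w :: "nat \<Rightarrow> nat"
    by (auto simp: left_shift_def)
  moreover have "left_shift w \<in> vertex_shift B E" if "w \<in> vertex_shift B E" for w
    using that by (auto simp: vertex_shift_def full_shift_def left_shift_def)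
  moreover have "l \<circ> w \<in> full_shift A" if "w \<in> vertex_shift B E" for w
  proof -
    have "w n \<in> B" for n using that by (auto simp: vertex_shift_def full_shift_def)
    then show ?thesis using assms(3) by (auto simp: full_shift_def image_subset_iff)
  qed
  ultimately have "subshift A ((\<lambda>w. l \<circ> w) ` vertex_shift B E)"
    using assms(1) by (auto simp: subshift_def)
  then show ?thesis
    using finite_type_vertex_shift[OF assms(2)] cont \<open>\<And>w. left_shift (l \<circ> w) = l \<circ> left_shift w\<close>
    unfolding sofic_def by metis
qed

section \<open>Markov partitions and the graph of their gaps\<close>

text \<open>Left-closed gaps suit orbits of \<open>T_plus\<close>, right-closed gaps those of
  \<open>T_minus\<close>.\<close>

lemma ex_gap:
  fixes s :: "nat \<Rightarrow> real"
  shows "s 0 \<le> x \<Longrightarrow> x < s m \<Longrightarrow> \<exists>i<m. s i \<le> x \<and> x < s (Suc i)"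
    and "s 0 < x \<Longrightarrow> x \<le> s m \<Longrightarrow> \<exists>i<m. s i < x \<and> x \<le> s (Suc i)"
  by (induction m) (force simp: less_Suc_eq not_le not_less)+

text \<open>The partition points are \<open>s 0 < \<dots> < s m\<close>; the letter \<open>i < m\<close> of the vertex
  shift stands for the gap between \<open>s i\<close> and \<open>s (Suc i)\<close>.\<close>

locale markov_partition =
  fixes \<beta> \<alpha> :: real and s :: "nat \<Rightarrow> real" and m :: nat
  assumes beta: "1 < \<beta>" and alpha: "0 \<le> \<alpha>" "\<alpha> \<le> 2 - \<beta>"
    and s_mono: "\<And>i j. i < j \<Longrightarrow> j \<le> m \<Longrightarrow> s i < s j"
    and s_ends: "s 0 = - \<alpha> / (\<beta> - 1)" "s m = (1 - \<alpha>) / (\<beta> - 1)"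
    and crit_in: "crit \<beta> \<alpha> \<in> s ` {..m}"
    and low_in: "\<And>i. i \<le> m \<Longrightarrow> s i \<le> crit \<beta> \<alpha> \<Longrightarrow> \<beta> * s i + \<alpha> \<in> s ` {..m}"
    and high_in: "\<And>i. i \<le> m \<Longrightarrow> crit \<beta> \<alpha> \<le> s i \<Longrightarrow> \<beta> * s i + \<alpha> - 1 \<in> s ` {..m}"
begin

text \<open>The critical point is a partition point, so each gap lies on one side of it and the left
  end tells which.\<close>

definition label :: "nat \<Rightarrow> nat" where
  "label i = (if s i < crit \<beta> \<alpha> then 0 else 1)"

text \<open>The Markov transition relation: the affine branch belonging to gap \<open>i\<close>
  stretches it over gap \<open>j\<close>.\<close>

definition edge :: "nat \<Rightarrow> nat \<Rightarrow> bool" where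
  "edge i j \<longleftrightarrow> \<beta> * s i + \<alpha> - label i \<le> s j \<and> s (Suc j) \<le> \<beta> * s (Suc i) + \<alpha> - label i"

lemma s_less_imp: "s i < s j \<Longrightarrow> i \<le> m \<Longrightarrow> i < j"
  by (metis linorder_neqE_nat order_less_asym s_mono)

lemma s_le: "i \<le> j \<Longrightarrow> j \<le> m \<Longrightarrow> s i \<le> s j"
  using s_mono[of i j] by (cases "i = j") auto

lemma s_Suc_le: "s i < s j \<Longrightarrow> i \<le> m \<Longrightarrow> j \<le> m \<Longrightarrow> s (Suc i) \<le> s j"
  by (simp add: Suc_leI s_le s_less_imp)

lemma label_0: "label i = 0 \<Longrightarrow> i < m \<Longrightarrow> s (Suc i) \<le> crit \<beta> \<alpha>"
  using crit_in s_Suc_le by (auto simp: label_def split: if_splits)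

lemma label_1: "label i \<noteq> 0 \<Longrightarrow> label i = 1 \<and> crit \<beta> \<alpha> \<le> s i"
  by (auto simp: label_def split: if_splits)

text \<open>Overlap already implies covering, because the image of a gap ends at partition points.
  For a gap ending at the critical point this uses that \<open>low_in\<close> and
  \<open>high_in\<close> both include that point.\<close>

lemma edgeI:
  assumes "i < m" "j < m" and "\<beta> * s i + \<alpha> - label i < s (Suc j)"
    and "s j < \<beta> * s (Suc i) + \<alpha> - label i"
  shows "edge i j"
proof -
  have "s i < s (Suc i)" using assms(1) by (simp add: s_mono)
  have "\<beta> * s k + \<alpha> - label i \<in> s ` {..m}" if "k = i \<or> k = Suc i" for k
  proof (cases "label i = 0")
    case True
    then show ?thesis
      using low_in[of k] that label_0[of i] assms(1) \<open>s i < s (Suc i)\<close> by auto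
  next
    case False
    then show ?thesis
      using high_in[of k] that label_1[of i] assms(1) \<open>s i < s (Suc i)\<close> by auto
  qed
  then obtain k k' where k: "k \<le> m" "\<beta> * s i + \<alpha> - label i = s k"
    and k': "k' \<le> m" "\<beta> * s (Suc i) + \<alpha> - label i = s k'"
    by (metis (no_types, lifting) atMost_iff imageE)
  have "s k \<le> s j" using assms(2,3) k s_less_imp[of k "Suc j"] s_le by auto
  moreover have "s (Suc j) \<le> s k'" using assms(2,4) k' s_Suc_le by auto
  ultimately show ?thesis using k k' by (simp add: edge_def)
qed

lemma crit_facts:
  shows "\<beta> * crit \<beta> \<alpha> + \<alpha> = 1" and "\<beta> * s 0 + \<alpha> = s 0" and "\<beta> * s m + \<alpha> - 1 = s m"
    and "s 0 \<le> 0" and "1 \<le> s m" and "s 0 < crit \<beta> \<alpha>" and "crit \<beta> \<alpha> < s m"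
proof -
  show "\<beta> * crit \<beta> \<alpha> + \<alpha> = 1" using beta by (simp add: crit_def)
  show "\<beta> * s 0 + \<alpha> = s 0" using beta by (simp add: s_ends field_simps)
  show "\<beta> * s m + \<alpha> - 1 = s m" using beta by (simp add: s_ends field_simps)
  show s0: "s 0 \<le> 0" using beta alpha by (simp add: s_ends)
  show "1 \<le> s m" using beta alpha by (simp add: s_ends field_simps)
  have "0 < crit \<beta> \<alpha>" using beta alpha by (simp add: crit_def)
  then show "s 0 < crit \<beta> \<alpha>" using s0 by simp
  show "crit \<beta> \<alpha> < s m"
    using beta alpha by (simp add: s_ends crit_def divide_strict_left_mono)
qed

text \<open>The lower branch stays below \<open>1 \<le> s m\<close>, the upper one does not drop
  below \<open>0 \<ge> s 0\<close>, and the ends are fixed points of the two branches.\<close>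

lemma T_plus_range:
  assumes "s 0 \<le> x" "x < s m"
  shows "s 0 \<le> T_plus \<beta> \<alpha> x \<and> T_plus \<beta> \<alpha> x < s m"
proof -
  have le: "\<beta> * s 0 \<le> \<beta> * x" "\<beta> * x < \<beta> * s m" using assms beta by simp_all
  show ?thesis
  proof (cases "x < crit \<beta> \<alpha>")
    case True
    then have "\<beta> * x < \<beta> * crit \<beta> \<alpha>" using beta by simp
    moreover have "T_plus \<beta> \<alpha> x = \<beta> * x + \<alpha>" using True by (simp add: T_plus_def)
    ultimately show ?thesis using le crit_facts by linarith
  next
    case False
    then have "\<beta> * crit \<beta> \<alpha> \<le> \<beta> * x" using beta by simp
    moreover have "T_plus \<beta> \<alpha> x = \<beta> * x + \<alpha> - 1" using False by (simp add: T_plus_def)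
    ultimately show ?thesis using le crit_facts by linarith
  qed
qed

lemma T_minus_range:
  assumes "s 0 < x" "x \<le> s m"
  shows "s 0 < T_minus \<beta> \<alpha> x \<and> T_minus \<beta> \<alpha> x \<le> s m"
proof -
  have le: "\<beta> * s 0 < \<beta> * x" "\<beta> * x \<le> \<beta> * s m" using assms beta by simp_all
  show ?thesis
  proof (cases "x \<le> crit \<beta> \<alpha>")
    case True
    then have "\<beta> * x \<le> \<beta> * crit \<beta> \<alpha>" using beta by simp
    moreover have "T_minus \<beta> \<alpha> x = \<beta> * x + \<alpha>" using True by (simp add: T_minus_def)
    ultimately show ?thesis using le crit_facts by linarith
  next
    case False
    then have "\<beta> * crit \<beta> \<alpha> < \<beta> * x" using beta by simp
    moreover have "T_minus \<beta> \<alpha> x = \<beta> * x + \<alpha> - 1" using False by (simp add: T_minus_def)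
    ultimately show ?thesis using le crit_facts by linarith
  qed
qed

section \<open>From expansions to paths\<close>

text \<open>The path records the left-closed gaps visited by the orbit. With this choice the
  critical point belongs to a gap labelled 1, in agreement with the digit of
  \<open>tau_plus\<close>.\<close>

lemma tau_plus_in_labels:
  assumes "s 0 \<le> x" "x < s m"
  shows "tau_plus \<beta> \<alpha> x \<in> (\<lambda>w. label \<circ> w) ` vertex_shift {..<m} edge"
proof -
  define y where "y n = (T_plus \<beta> \<alpha> ^^ n) x" for n
  have "s 0 \<le> y n \<and> y n < s m" for n
    by (induction n) (use assms T_plus_range in \<open>auto simp: y_def\<close>)
  then have "\<forall>n. \<exists>i<m. s i \<le> y n \<and> y n < s (Suc i)" using ex_gap(1) by blast
  then obtain w where w: "\<And>n. w n < m" "\<And>n. s (w n) \<le> y n" "\<And>n. y n < s (Suc (w n))" by metis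
  have lab: "label (w n) = (if y n < crit \<beta> \<alpha> then 0 else 1)" for n
    using w[of n] label_0[of "w n"] label_1[of "w n"] by fastforce
  have step: "y (Suc n) = \<beta> * y n + \<alpha> - label (w n)" for n
    by (simp add: y_def T_plus_def lab[unfolded y_def])
  \<comment> \<open>The next orbit point lies both in the image of the present gap and in the next
    gap, so the two overlap.\<close>
  have "edge (w n) (w (Suc n))" for n
  proof (rule edgeI)
    have "\<beta> * s (w n) \<le> \<beta> * y n" "\<beta> * y n < \<beta> * s (Suc (w n))" using w beta by simp_all
    then show "\<beta> * s (w n) + \<alpha> - label (w n) < s (Suc (w (Suc n)))"
      "s (w (Suc n)) < \<beta> * s (Suc (w n)) + \<alpha> - label (w n)"
      using w[of "Suc n"] step[of n] by linarith+
  qed (use w in auto)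
  then have "w \<in> vertex_shift {..<m} edge" using w(1) by (auto simp: vertex_shift_def full_shift_def)
  moreover have "tau_plus \<beta> \<alpha> x = label \<circ> w" by (auto simp: tau_plus_def lab y_def)
  ultimately show ?thesis by blast
qed

lemma tau_minus_in_labels:
  assumes "s 0 < x" "x \<le> s m"
  shows "tau_minus \<beta> \<alpha> x \<in> (\<lambda>w. label \<circ> w) ` vertex_shift {..<m} edge"
proof -
  define y where "y n = (T_minus \<beta> \<alpha> ^^ n) x" for n
  have "s 0 < y n \<and> y n \<le> s m" for n
    by (induction n) (use assms T_minus_range in \<open>auto simp: y_def\<close>)
  then have "\<forall>n. \<exists>i<m. s i < y n \<and> y n \<le> s (Suc i)" using ex_gap(2) by blast
  then obtain w where w: "\<And>n. w n < m" "\<And>n. s (w n) < y n" "\<And>n. y n \<le> s (Suc (w n))" by metis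
  have lab: "label (w n) = (if y n \<le> crit \<beta> \<alpha> then 0 else 1)" for n
    using w[of n] label_0[of "w n"] label_1[of "w n"] by fastforce
  have step: "y (Suc n) = \<beta> * y n + \<alpha> - label (w n)" for n
    by (simp add: y_def T_minus_def lab[unfolded y_def])
  have "edge (w n) (w (Suc n))" for n
  proof (rule edgeI)
    have "\<beta> * s (w n) < \<beta> * y n" "\<beta> * y n \<le> \<beta> * s (Suc (w n))" using w beta by simp_all
    then show "\<beta> * s (w n) + \<alpha> - label (w n) < s (Suc (w (Suc n)))"
      "s (w (Suc n)) < \<beta> * s (Suc (w n)) + \<alpha> - label (w n)"
      using w[of "Suc n"] step[of n] by linarith+
  qed (use w in auto)
  then have "w \<in> vertex_shift {..<m} edge" using w(1) by (auto simp: vertex_shift_def full_shift_def)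
  moreover have "tau_minus \<beta> \<alpha> x = label \<circ> w" by (auto simp: tau_minus_def lab y_def)
  ultimately show ?thesis by blast
qed

lemma Omega_subset_labels: "Omega \<beta> \<alpha> \<subseteq> (\<lambda>w. label \<circ> w) ` vertex_shift {..<m} edge"
proof -
  have fix0: "(T_plus \<beta> \<alpha> ^^ n) (s 0) = s 0" "(T_minus \<beta> \<alpha> ^^ n) (s 0) = s 0" for n
    by (induction n) (use crit_facts in \<open>auto simp: T_plus_def T_minus_def\<close>)
  have fixm: "(T_plus \<beta> \<alpha> ^^ n) (s m) = s m" "(T_minus \<beta> \<alpha> ^^ n) (s m) = s m" for n
    by (induction n) (use crit_facts in \<open>auto simp: T_plus_def T_minus_def\<close>)
  \<comment> \<open>These two expansions are outside the half-open ranges treated above. Both maps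
    fix the end point and produce the same constant word.\<close>
  have ends: "tau_minus \<beta> \<alpha> (s 0) = tau_plus \<beta> \<alpha> (s 0)" "tau_plus \<beta> \<alpha> (s m) = tau_minus \<beta> \<alpha> (s m)"
    using crit_facts by (auto simp: tau_plus_def tau_minus_def fix0 fixm)
  have "s 0 < s m" using crit_facts by linarith
  have "tau_plus \<beta> \<alpha> x \<in> (\<lambda>w. label \<circ> w) ` vertex_shift {..<m} edge \<and>
      tau_minus \<beta> \<alpha> x \<in> (\<lambda>w. label \<circ> w) ` vertex_shift {..<m} edge" if "x \<in> J \<beta> \<alpha>" for x
  proof -
    have "s 0 \<le> x" "x \<le> s m" using that by (auto simp: J_def s_ends)
    then show ?thesis
      using tau_plus_in_labels[of x] tau_minus_in_labels[of x] ends \<open>s 0 < s m\<close>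
        tau_plus_in_labels[of "s 0"] tau_minus_in_labels[of "s m"]
      by (metis order_le_less order_refl)
  qed
  then show ?thesis by (auto simp: Omega_def Omega_plus_def Omega_minus_def)
qed

section \<open>From paths to expansions\<close>

text \<open>Solving the recurrence backwards contracts by \<open>1 / \<beta>\<close> and yields the
  series of \<open>(d (n + k) - \<alpha>) / \<beta> ^ Suc k\<close>, whose value at
  \<open>n = 0\<close> is the point coded by \<open>d\<close>.\<close>

lemma ex_bounded_orbit:
  fixes d :: "nat \<Rightarrow> nat"
  assumes "\<And>n. d n \<le> 1"
  obtains y C where "\<And>n. y (Suc n) = \<beta> * y n + \<alpha> - d n" "\<And>n. \<bar>y n\<bar> \<le> (C :: real)"
proof -
  define f where "f n k = (real (d (n + k)) - \<alpha>) / \<beta> ^ Suc k" for n k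
  have g: "summable (\<lambda>k. (1 / \<beta>) ^ Suc k)"
    using beta by (subst summable_Suc_iff) (auto intro: summable_geometric)
  have bd: "norm (f n k) \<le> (1 / \<beta>) ^ Suc k" for n k
  proof -
    have "\<bar>real (d (n + k)) - \<alpha>\<bar> \<le> 1" using assms[of "n + k"] alpha beta by linarith
    then show ?thesis using beta unfolding f_def
      by (simp add: abs_divide power_one_over divide_right_mono del: power_Suc)
  qed
  have sm: "summable (f n)" for n by (rule summable_comparison_test'[OF g bd])
  have rec: "suminf (f (Suc n)) = \<beta> * suminf (f n) + \<alpha> - d n" for n
  proof -
    have "f (Suc n) = (\<lambda>k. \<beta> * f n (Suc k))" using beta by (auto simp: f_def)
    then have "suminf (f (Suc n)) = \<beta> * (\<Sum>k. f n (Suc k))"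
      using sm[of n] by (simp add: suminf_mult summable_Suc_iff)
    also have "\<dots> = \<beta> * (suminf (f n) - f n 0)" using suminf_split_head[OF sm] by simp
    also have "\<dots> = \<beta> * suminf (f n) + \<alpha> - d n" using beta by (simp add: f_def field_simps)
    finally show ?thesis .
  qed
  have "\<bar>suminf (f n)\<bar> \<le> (\<Sum>k. (1 / \<beta>) ^ Suc k)" for n
    using norm_suminf_le[OF bd g] by simp
  then show ?thesis using that[of "\<lambda>n. suminf (f n)"] rec by blast
qed

text \<open>A positive value would grow at least geometrically. It is applied to the distance by
  which an orbit overshoots its gap on either side.\<close>

lemma expanding_unbounded:
  fixes z :: "nat \<Rightarrow> real"
  assumes step: "\<And>n. z n > 0 \<Longrightarrow> z (Suc n) \<ge> \<beta> * z n" and bd: "\<And>n. z n \<le> C"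
  shows "z n \<le> 0"
proof (rule ccontr)
  assume "\<not> z n \<le> 0"
  then have pos: "z n > 0" by simp
  have grow: "\<beta> ^ k * z n \<le> z (n + k)" for k
  proof (induction k)
    case (Suc k)
    have "0 < \<beta> ^ k * z n" using pos beta by simp
    then have "z (n + k) > 0" using Suc by linarith
    moreover have "\<beta> * (\<beta> ^ k * z n) \<le> \<beta> * z (n + k)" using Suc beta by simp
    ultimately show ?case using step[of "n + k"] by (simp add: mult.assoc)
  qed simp
  obtain k where "C / z n < \<beta> ^ k" using real_arch_pow beta by blast
  then have "C < \<beta> ^ k * z n" using pos by (simp add: field_simps)
  then show False using grow[of k] bd[of "n + k"] by linarith
qed

text \<open>Once the orbit of a point following a path sits at an endpoint of its gap, it stays at the
  endpoint on the same side. Hence every visit to the critical point carries the same letter,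
  and one of the two expansion maps reads off the whole word.\<close>

lemma labels_subset_Omega: "(\<lambda>w. label \<circ> w) ` vertex_shift {..<m} edge \<subseteq> Omega \<beta> \<alpha>"
proof
  fix d assume "d \<in> (\<lambda>w. label \<circ> w) ` vertex_shift {..<m} edge"
  then obtain w where d: "\<And>n. d n = label (w n)" and wm: "\<And>n. w n < m"
    and e: "\<And>n. edge (w n) (w (Suc n))"
    by (fastforce simp: vertex_shift_def full_shift_def)
  have d01: "d n \<le> 1" for n by (simp add: d label_def)
  obtain y C where y: "\<And>n. y (Suc n) = \<beta> * y n + \<alpha> - d n" and C: "\<And>n. \<bar>y n\<bar> \<le> C"
    using ex_bounded_orbit[of d] d01 by metis
  have lo: "\<beta> * s (w n) + \<alpha> - d n \<le> s (w (Suc n))"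
    and hi: "s (Suc (w (Suc n))) \<le> \<beta> * s (Suc (w n)) + \<alpha> - d n" for n
    using e[of n] by (auto simp: edge_def d)
  have sb: "s 0 \<le> s (w n)" "s (w n) < s (Suc (w n))" "s (Suc (w n)) \<le> s m" for n
    using wm[of n] by (auto intro: s_le s_mono)
  \<comment> \<open>Along an edge any overshoot is multiplied by at least \<beta>, so the bounded
    orbit \<open>y\<close> stays in the closed gaps of the path.\<close>
  have L: "s (w n) \<le> y n" for n
  proof -
    have "s (w n) - y n \<le> 0"
    proof (rule expanding_unbounded[of "\<lambda>n. s (w n) - y n" "s m + C"])
      show "s (w n) - y n \<le> s m + C" for n using sb[of n] C[of n] by linarith
      show "\<beta> * (s (w n) - y n) \<le> s (w (Suc n)) - y (Suc n)" for n
        using lo[of n] y[of n] by (simp add: algebra_simps)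
    qed
    then show ?thesis by simp
  qed
  have R: "y n \<le> s (Suc (w n))" for n
  proof -
    have "y n - s (Suc (w n)) \<le> 0"
    proof (rule expanding_unbounded[of "\<lambda>n. y n - s (Suc (w n))" "C - s 0"])
      show "y n - s (Suc (w n)) \<le> C - s 0" for n using sb[of n] C[of n] by linarith
      show "\<beta> * (y n - s (Suc (w n))) \<le> y (Suc n) - s (Suc (w (Suc n)))" for n
        using hi[of n] y[of n] by (simp add: algebra_simps)
    qed
    then show ?thesis by simp
  qed
  have d0: "d n = 0" if "y n < crit \<beta> \<alpha>" for n
    using label_1[of "w n"] L[of n] that by (force simp: d)
  have d1: "d n = 1" if "y n > crit \<beta> \<alpha>" for n
    using label_0[of "w n"] label_1[of "w n"] R[of n] wm[of n] that by (force simp: d)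
  \<comment> \<open>By \<open>lo\<close> the image of a left end is at most the next left end; by
    \<open>L\<close> it is at least that.\<close>
  have left: "y (n + k) = s (w (n + k))" if "y n = s (w n)" for n k
  proof (induction k)
    case (Suc k)
    then show ?case using y[of "n + k"] lo[of "n + k"] L[of "Suc (n + k)"] by simp
  qed (use that in simp)
  have right: "y (n + k) = s (Suc (w (n + k)))" if "y n = s (Suc (w n))" for n k
  proof (induction k)
    case (Suc k)
    then show ?case using y[of "n + k"] hi[of "n + k"] R[of "Suc (n + k)"] by simp
  qed (use that in simp)
  have same: "d n = d k" if "y n = crit \<beta> \<alpha>" "y k = crit \<beta> \<alpha>" "n \<le> k" for n k
  proof -
    obtain j where k: "k = n + j" using \<open>n \<le> k\<close> le_Suc_ex by blast
    show ?thesis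
    proof (cases "d n = 0")
      case True
      \<comment> \<open>A gap labelled 0 lies left of the critical point and can touch it only with
        its right end.\<close>
      then have "y n = s (Suc (w n))" using label_0[of "w n"] R[of n] wm[of n] that by (simp add: d)
      then have "s (w k) < crit \<beta> \<alpha>" using right[of n j] sb(2)[of k] that k by simp
      then show ?thesis using True by (simp add: d[of k] label_def)
    next
      case False
      then have "y n = s (w n)" using label_1[of "w n"] L[of n] that by (simp add: d)
      then have "s (w k) = crit \<beta> \<alpha>" using left[of n j] that k by simp
      then show ?thesis using False label_1[of "w n"] by (simp add: d label_def)
    qed
  qed
  have y0: "y 0 \<in> J \<beta> \<alpha>"
    using L[of 0] R[of 0] sb[of 0] unfolding J_def s_ends[symmetric] atLeastAtMost_iff by linarith
  \<comment> \<open>Letter 0 at the critical point is the convention of \<open>T_minus\<close>,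
    letter 1 that of \<open>T_plus\<close>. An orbit missing the point falls under the second
    case.\<close>
  show "d \<in> Omega \<beta> \<alpha>"
  proof (cases "\<exists>n. y n = crit \<beta> \<alpha> \<and> d n = 0")
    case True
    then have crit0: "d n = 0" if "y n = crit \<beta> \<alpha>" for n
      using same that by (metis nat_le_linear)
    then have dn: "d n = (if y n \<le> crit \<beta> \<alpha> then 0 else 1)" for n
      using d0[of n] d1[of n] by force
    have "(T_minus \<beta> \<alpha> ^^ n) (y 0) = y n" for n
      by (induction n) (auto simp: T_minus_def y dn)
    then have "d = tau_minus \<beta> \<alpha> (y 0)" by (auto simp: tau_minus_def dn)
    then show ?thesis using y0 by (auto simp: Omega_def Omega_minus_def)
  next
    case False
    then have "d n = 1" if "y n = crit \<beta> \<alpha>" for n using that d01[of n] by fastforce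
    then have dn: "d n = (if y n < crit \<beta> \<alpha> then 0 else 1)" for n
      using d0[of n] d1[of n] by force
    have "(T_plus \<beta> \<alpha> ^^ n) (y 0) = y n" for n
      by (induction n) (auto simp: T_plus_def y dn)
    then have "d = tau_plus \<beta> \<alpha> (y 0)" by (auto simp: tau_plus_def dn)
    then show ?thesis using y0 by (auto simp: Omega_def Omega_plus_def)
  qed
qed

lemma sofic_Omega: "sofic {0, 1} (Omega \<beta> \<alpha>)"
proof -
  have "Omega \<beta> \<alpha> = (\<lambda>w. label \<circ> w) ` vertex_shift {..<m} edge"
    using Omega_subset_labels labels_subset_Omega by blast
  moreover have "label ` {..<m} \<subseteq> {0, 1}" by (auto simp: label_def)
  ultimately show ?thesis using sofic_labelled_vertex_shift[of "{0, 1}" "{..<m}" label edge] by simp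
qed

end

text \<open>The increasing enumeration of \<open>S\<close> is the partition. As \<open>S\<close>
  lies in \<open>J \<beta> \<alpha>\<close> and contains its end points, these come first and
  last.\<close>

lemma sofic_Omega_if_finite_invariant:
  fixes \<beta> \<alpha> :: real
  assumes "1 < \<beta>" "0 \<le> \<alpha>" "\<alpha> \<le> 2 - \<beta>"
    and S: "finite S" "S \<subseteq> J \<beta> \<alpha>"
    and ends: "- \<alpha> / (\<beta> - 1) \<in> S" "(1 - \<alpha>) / (\<beta> - 1) \<in> S" "crit \<beta> \<alpha> \<in> S"
    and low: "\<And>x. x \<in> S \<Longrightarrow> x \<le> crit \<beta> \<alpha> \<Longrightarrow> \<beta> * x + \<alpha> \<in> S"
    and high: "\<And>x. x \<in> S \<Longrightarrow> crit \<beta> \<alpha> \<le> x \<Longrightarrow> \<beta> * x + \<alpha> - 1 \<in> S"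
  shows "sofic {0, 1} (Omega \<beta> \<alpha>)"
proof -
  \<comment> \<open>The number of gaps, one less than the number of points; \<open>S\<close> is
    nonempty, so nothing is truncated.\<close>
  define m where "m = card S - 1"
  define s where "s i = sorted_list_of_set S ! i" for i
  have "card S > 0" using S ends by (auto simp: card_gt_0_iff)
  then have lt: "i \<le> m \<longleftrightarrow> i < card S" for i by (auto simp: m_def)
  have im: "s ` {..m} = S"
  proof -
    have "S = set (sorted_list_of_set S)" using S by simp
    also have "\<dots> = s ` {..m}" by (auto simp: set_conv_nth s_def lt image_iff)
    finally show ?thesis ..
  qed
  have mono: "s i < s j" if "i < j" "j \<le> m" for i j
    using that sorted_wrt_nth_less[OF strict_sorted_list_of_set[of S], of i j]
    by (simp add: s_def lt)
  have le: "s i \<le> s j" if "i \<le> j" "j \<le> m" for i j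
    using mono[of i j] that by (cases "i = j") auto
  have "s 0 = - \<alpha> / (\<beta> - 1)"
  proof (rule antisym)
    show "s 0 \<le> - \<alpha> / (\<beta> - 1)" using ends(1) le unfolding im[symmetric] by auto
    show "- \<alpha> / (\<beta> - 1) \<le> s 0" using S(2) unfolding im[symmetric] by (auto simp: J_def)
  qed
  moreover have "s m = (1 - \<alpha>) / (\<beta> - 1)"
  proof (rule antisym)
    show "(1 - \<alpha>) / (\<beta> - 1) \<le> s m" using ends(2) le unfolding im[symmetric] by auto
    show "s m \<le> (1 - \<alpha>) / (\<beta> - 1)" using S(2) unfolding im[symmetric] by (auto simp: J_def)
  qed
  ultimately interpret markov_partition \<beta> \<alpha> s m
    using assms im mono by unfold_locales auto
  show ?thesis by (rule sofic_Omega)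
qed

section \<open>Rational translation parameters\<close>

lemma sofic_Omega_rational:
  fixes \<beta> \<alpha> :: real
  assumes "1 < \<beta>" "pisot \<beta>" and alpha: "0 \<le> \<alpha>" "\<alpha> \<le> 2 - \<beta>" and "\<alpha> \<in> \<rat>"
  shows "sofic {0, 1} (Omega \<beta> \<alpha>)"
proof -
  obtain r where r: "0 \<le> r" "r < 1"
    and conj: "\<And>z. galois_conjugate \<beta> z \<Longrightarrow> z \<noteq> of_real \<beta> \<Longrightarrow> cmod z \<le> r"
    using pisot_conjugate_bound[OF assms(2)] by metis
  obtain a q :: int where q: "q > 0" and aq: "\<alpha> = of_int a / of_int q"
    using assms(5) by (auto elim: Rats_cases')
  have qa: "of_int q * \<alpha> = of_int a" using q aq by simp
  \<comment> \<open>The fixed point of \<open>t \<mapsto> r * t + q\<close>: a branch multiplies a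
    conjugate by some \<open>z\<close> of modulus at most \<open>r\<close> and adds the integer
    \<open>a - q * d\<close>, of modulus at most \<open>q\<close>.\<close>
  define M where "M = of_int q / (1 - r)"
  \<comment> \<open>One bound for the conjugates and for \<open>q * x\<close> itself, the latter
    from the size of \<open>J \<beta> \<alpha>\<close>.\<close>
  define K where "K = max M (of_int q / (\<beta> - 1))"
  have "of_int q \<le> M" using r q by (simp add: M_def le_divide_eq_1 divide_le_eq field_simps)
  have M_step: "r * M + of_int q = M" using r by (simp add: M_def field_simps)
  define conj_le :: "int poly \<Rightarrow> bool" where
    "conj_le P \<longleftrightarrow> (\<forall>z. galois_conjugate \<beta> z \<and> z \<noteq> of_real \<beta> \<longrightarrow> cmod (poly (map_poly of_int P) z) \<le> M)"
    for P
  define S0 where "S0 = {x \<in> J \<beta> \<alpha>. \<exists>P. of_int q * x = poly (map_poly of_int P) \<beta> \<and> conj_le P}"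
  define p where "p = crit \<beta> \<alpha>"
  define lo hi where "lo = - \<alpha> / (\<beta> - 1)" and "hi = (1 - \<alpha>) / (\<beta> - 1)"
  have J: "J \<beta> \<alpha> = {lo..hi}" by (simp add: J_def lo_def hi_def)
  have fixed: "\<beta> * lo + \<alpha> = lo" "\<beta> * hi + \<alpha> - 1 = hi" "\<beta> * p + \<alpha> = 1"
    using assms(1) by (simp_all add: lo_def hi_def p_def crit_def field_simps)
  have "lo \<le> 0" "1 \<le> hi" using assms(1) alpha by (simp_all add: lo_def hi_def field_simps)
  have "0 < p" "p < hi"
    using assms(1) alpha by (simp_all add: p_def crit_def hi_def divide_strict_left_mono)
  have J_abs: "\<bar>x\<bar> \<le> 1 / (\<beta> - 1)" if "x \<in> J \<beta> \<alpha>" for x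
  proof -
    have "- 1 / (\<beta> - 1) \<le> lo" "hi \<le> 1 / (\<beta> - 1)"
      using assms(1) alpha unfolding lo_def hi_def by (intro divide_right_mono; simp)+
    then show ?thesis using that by (auto simp: J abs_le_iff)
  qed
  have step: "\<beta> * x + \<alpha> - of_int d \<in> S0"
    if x: "x \<in> S0" and d: "d \<in> {0, 1}" and J': "\<beta> * x + \<alpha> - of_int d \<in> J \<beta> \<alpha>" for x d
  proof -
    obtain P where P: "of_int q * x = poly (map_poly of_int P) \<beta>" "conj_le P"
      using x by (auto simp: S0_def)
    \<comment> \<open>Prepending a coefficient to \<open>P\<close> multiplies its value by \<beta>
      and adds that coefficient.\<close>
    have eval: "of_int q * (\<beta> * x + \<alpha> - of_int d) = poly (map_poly of_int (pCons (a - q * d) P)) \<beta>"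
      by (simp add: map_poly_of_int_hom P(1)[symmetric] qa[symmetric] algebra_simps)
    have "\<bar>of_int (a - q * d)\<bar> \<le> (of_int q :: real)"
    proof -
      have "of_int (a - q * d) = of_int q * (\<alpha> - of_int d)" using qa by (simp add: algebra_simps)
      moreover have "\<bar>\<alpha> - of_int d\<bar> \<le> 1" using d alpha assms(1) by auto
      ultimately show ?thesis using q by (simp add: abs_mult mult_left_le)
    qed
    then have cd: "cmod (of_int (a - q * d)) \<le> of_int q" by (simp only: norm_of_int)
    have "conj_le (pCons (a - q * d) P)"
      unfolding conj_le_def
    proof (intro allI impI)
      fix z assume z: "galois_conjugate \<beta> z \<and> z \<noteq> of_real \<beta>"
      have "cmod (z * poly (map_poly of_int P) z) \<le> r * M"
        unfolding norm_mult using z P(2) conj[of z] r by (intro mult_mono) (auto simp: conj_le_def)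
      then have "cmod (of_int (a - q * d) + z * poly (map_poly of_int P) z) \<le> of_int q + r * M"
        using cd norm_triangle_mono by blast
      then show "cmod (poly (map_poly of_int (pCons (a - q * d) P)) z) \<le> M"
        using M_step by (simp add: map_poly_of_int_hom add.commute)
    qed
    then show ?thesis using eval J' unfolding S0_def by blast
  qed
  \<comment> \<open>These are the two images of the critical point, which itself need not belong to
    \<open>S0\<close>.\<close>
  have S0_01: "0 \<in> S0" "1 \<in> S0"
  proof -
    have "0 \<in> J \<beta> \<alpha>" "1 \<in> J \<beta> \<alpha>" using \<open>lo \<le> 0\<close> \<open>1 \<le> hi\<close> by (auto simp: J)
    moreover have "conj_le 0" "conj_le [:q:]"
      using \<open>of_int q \<le> M\<close> q by (auto simp: conj_le_def map_poly_of_int_hom)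
    ultimately show "0 \<in> S0" "1 \<in> S0"
      unfolding S0_def by (auto intro: exI[of _ 0] exI[of _ "[:q:]"] simp: map_poly_of_int_hom)
  qed
  have "finite S0"
  proof (rule finite_subset)
    show "S0 \<subseteq> {x. \<bar>of_int q * x\<bar> \<le> K \<and> (\<exists>P :: int poly. of_int q * x = poly (map_poly of_int P) \<beta> \<and>
      (\<forall>z. galois_conjugate \<beta> z \<and> z \<noteq> of_real \<beta> \<longrightarrow> cmod (poly (map_poly of_int P) z) \<le> K))}"
    proof
      fix x assume x: "x \<in> S0"
      then have "\<bar>of_int q * x\<bar> \<le> of_int q * (1 / (\<beta> - 1))"
        using J_abs[of x] q unfolding abs_mult by (auto simp: S0_def intro!: mult_left_mono simp del: times_divide_eq_right)
      then have "\<bar>of_int q * x\<bar> \<le> K" by (simp add: K_def)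
      moreover obtain P where "of_int q * x = poly (map_poly of_int P) \<beta>" "conj_le P"
        using x by (auto simp: S0_def)
      moreover have "M \<le> K" by (simp add: K_def)
      ultimately show "x \<in> {x. \<bar>of_int q * x\<bar> \<le> K \<and>
        (\<exists>P :: int poly. of_int q * x = poly (map_poly of_int P) \<beta> \<and>
        (\<forall>z. galois_conjugate \<beta> z \<and> z \<noteq> of_real \<beta> \<longrightarrow> cmod (poly (map_poly of_int P) z) \<le> K))}"
        unfolding conj_le_def using order_trans by blast
    qed
    show "finite \<dots>"
      using finite_bounded_conjugates[of \<beta> "of_int q" K] assms(2) q by (simp add: pisot_def)
  qed
  show ?thesis
  proof (rule sofic_Omega_if_finite_invariant)
    \<comment> \<open>The three added points preserve invariance: \<open>lo\<close> and
      \<open>hi\<close> are fixed by their branches, and \<open>p\<close> is sent to 1 and 0 in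
      \<open>S0\<close>.\<close>
    show "finite (insert lo (insert hi (insert p S0)))" using \<open>finite S0\<close> by simp
    show "insert lo (insert hi (insert p S0)) \<subseteq> J \<beta> \<alpha>"
      using \<open>lo \<le> 0\<close> \<open>1 \<le> hi\<close> \<open>0 < p\<close> \<open>p < hi\<close> by (auto simp: J S0_def)
    show "\<beta> * x + \<alpha> \<in> insert lo (insert hi (insert p S0))"
      if x: "x \<in> insert lo (insert hi (insert p S0))" and xp: "x \<le> crit \<beta> \<alpha>" for x
    proof -
      consider "x = lo" | "x = p" | "x \<in> S0" using x xp \<open>p < hi\<close> by (auto simp: p_def)
      then show ?thesis
      proof cases
        case 3
        then have "\<beta> * lo \<le> \<beta> * x" "\<beta> * x \<le> \<beta> * p"
          using xp assms(1) by (auto simp: S0_def J p_def)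
        then have "\<beta> * x + \<alpha> \<in> J \<beta> \<alpha>" using fixed \<open>1 \<le> hi\<close> unfolding J atLeastAtMost_iff by linarith
        then show ?thesis using step[OF 3, of 0] by simp
      qed (use fixed S0_01 in auto)
    qed
    show "\<beta> * x + \<alpha> - 1 \<in> insert lo (insert hi (insert p S0))"
      if x: "x \<in> insert lo (insert hi (insert p S0))" and xp: "crit \<beta> \<alpha> \<le> x" for x
    proof -
      consider "x = hi" | "x = p" | "x \<in> S0" using x xp \<open>lo \<le> 0\<close> \<open>0 < p\<close> by (auto simp: p_def)
      then show ?thesis
      proof cases
        case 3
        then have "\<beta> * p \<le> \<beta> * x" "\<beta> * x \<le> \<beta> * hi"
          using xp assms(1) by (auto simp: S0_def J p_def)
        then have "\<beta> * x + \<alpha> - 1 \<in> J \<beta> \<alpha>" using fixed \<open>lo \<le> 0\<close> unfolding J atLeastAtMost_iff by linarith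
        then show ?thesis using step[OF 3, of 1] by simp
      qed (use fixed S0_01 in auto)
    qed
  qed (use assms alpha in \<open>auto simp: lo_def hi_def p_def\<close>)
qed

theorem corollary1p3:
  fixes \<beta> :: real
  assumes "1 < \<beta>" and "\<beta> < 2" and "pisot \<beta>"
  shows "Delta \<beta> \<subseteq> closure {(b, \<alpha>). (b, \<alpha>) \<in> Delta \<beta> \<and> sofic {0, 1} (Omega b \<alpha>)}"
proof
  fix v assume "v \<in> Delta \<beta>"
  then obtain \<alpha> where v: "v = (\<beta>, \<alpha>)" and \<alpha>: "0 \<le> \<alpha>" "\<alpha> \<le> 2 - \<beta>" by (auto simp: Delta_def)
  show "v \<in> closure {(b, \<alpha>). (b, \<alpha>) \<in> Delta \<beta> \<and> sofic {0, 1} (Omega b \<alpha>)}"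
    unfolding closure_approachable
  proof (intro allI impI)
    fix e :: real assume "0 < e"
    \<comment> \<open>Since \<open>\<beta> < 2\<close>, the parameter interval has positive length,
      so the window contains rationals of its interior even when \<alpha> is an end point.\<close>
    then have "max 0 (\<alpha> - e) < min (2 - \<beta>) (\<alpha> + e)" using \<alpha> assms(2) by auto
    then obtain \<gamma> where \<gamma>: "\<gamma> \<in> \<rat>" "max 0 (\<alpha> - e) < \<gamma>" "\<gamma> < min (2 - \<beta>) (\<alpha> + e)"
      using Rats_dense_in_real by blast
    then have "sofic {0, 1} (Omega \<beta> \<gamma>)" using assms by (intro sofic_Omega_rational) auto
    moreover have "(\<beta>, \<gamma>) \<in> Delta \<beta>" using \<gamma> by (auto simp: Delta_def)
    moreover have "dist (\<beta>, \<gamma>) v < e" using \<gamma> by (auto simp: v dist_Pair_Pair dist_real_def abs_less_iff)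
    ultimately show "\<exists>y\<in>{(b, \<alpha>). (b, \<alpha>) \<in> Delta \<beta> \<and> sofic {0, 1} (Omega b \<alpha>)}. dist y v < e"
      by (intro bexI[of _ "(\<beta>, \<gamma>)"]) auto
  qed
qed

end
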